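(* A class $\mathcal{K}$ of causal multiteams of signature $\sigma$ is definable in $\mathcal{P}^-$ if and only if $\mathcal{K}$ is monic, has the empty multiteam property, and is closed under change of laws and rescaling. $\mathcal{K}$ is definable in $\mathcal{P}$ if and only if $\mathcal{K}$ is signed monic, has the empty multiteam property, and is closed under change of laws and rescaling.
   Context: Fix a finite signature $\sigma=(\mathrm{Dom},\mathrm{Ran})$ (a finite set of variables, each with a finite range). A causal multiteam $T=(T^-,\mathcal F)$ of signature $\sigma$ consists of a finite multiset $T^-$ of assignments on $\mathrm{Dom}$ and a function component $\mathcal F$ assigning to each endogenous variable $V$ a non-constant function $\mathcal F_V$ of the remaining variables, compatible with all assignments of $T^-$ (with acyclic causal graph). The language $\mathcal{PCO}$ is built from $\mathcal{CO}$ literals $Y=y$, $Y\neq y$ and probabilistic atoms $\Pr(\alpha)\geq\epsilon$, $\Pr(\alpha)>\epsilon$, $\Pr(\alpha)\geq\Pr(\beta)$, $\Pr(\alpha)>\Pr(\beta)$ (with $\alpha,\beta\in\mathcal{CO}$, $\epsilon\in[0,1]\cap\mathbb Q$; evaluated by counting probability, and true on the empty multiteam), closed under $\land$, global disjunction $\sqcup$, selective implication $\alpha\supset\varphi$ and interventionist counterfactual $\mathbf X=\mathbf x\,\Box\!\!\rightarrow\varphi$. $\mathcal{CO}$ consists of literals closed under $\land$, tensor disjunction $\lor$, $\supset$ and $\Box\!\!\rightarrow$. $\mathcal{P}$ is the fragment of $\mathcal{PCO}$ without $\supset$ and without $\Box\!\!\rightarrow$ (at the outer level); $\mathcal{P}^-$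 is $\mathcal{P}$ without comparison atoms $\Pr(\alpha)\geq\Pr(\beta)$, $\Pr(\alpha)>\Pr(\beta)$. A class has the empty multiteam property if it contains all empty causal multiteams of signature $\sigma$; it is closed under rescaling if it contains every causal multiteam with the same function component and the same relative frequency of each assignment as one of its members (or both empty); it is closed under change of laws if $(T^-,\mathcal F)\in\mathcal K$ implies $(T^-,\mathcal G)\in\mathcal K$ for every function component $\mathcal G$ of signature $\sigma$. Enumerating the assignments of signature $\sigma$ as $s_1,\dots,s_n$, each nonempty $T$ has probability vector $(\epsilon^T_{s_1},\dots,\epsilon^T_{s_n})$ in the simplex $\Delta^{n-1}$, where $\epsilon^T_s$ is the proportion of copies of $s$ in $T^-$; the probability set of $\mathcal K$ is the set of probability vectors of its nonempty members. A linear inequality $a_1\epsilon_1+\dots+a_n\epsilon_n\vartriangleleft b$ ($\vartriangleleft\in\{\geq,\leq,>,<\}$, $a_i,b\in\mathbb Q$) is monic if all $a_i\in\{0,1\}$ and signed monic if all $a_i\in\{0,1,-1\}$; $\mathcal K$ is (signed) monic if its probability set is a finite union of subsets of $\Delta^{n-1}$ defined by finite systems of (signed) monic inequalities.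
   Formalization: Signed monic here also requires b=0 when both 1 and -1 occur among the a_i (else ε1-ε2≥1/2 on three assignments refutes the claim); counterfactuals are excluded from P also inside Pr (else closure under change of laws fails); the simplex is that of rational vectors. *)

theory Defs
  imports Complex_Main "HOL-Library.Multiset" "HOL-Library.FuncSet"
begin

record ('v, 'a) sig =
  Dom :: "'v set"
  Ran :: "'v \<Rightarrow> 'a set"

definition signature :: "('v, 'a) sig \<Rightarrow> bool" where
  "signature \<sigma> \<longleftrightarrow> finite (Dom \<sigma>) \<and> Dom \<sigma> \<noteq> {} \<and>
     (\<forall>X\<in>Dom \<sigma>. finite (Ran \<sigma> X) \<and> Ran \<sigma> X \<noteq> {})"

definition assignments :: "('v, 'a) sig \<Rightarrow> ('v \<Rightarrow> 'a) set" where
  "assignments \<sigma> = Pi\<^sub>E (Dom \<sigma>) (Ran \<sigma>)"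

definition other_values :: "('v, 'a) sig \<Rightarrow> 'v \<Rightarrow> ('v \<Rightarrow> 'a) set" where
  "other_values \<sigma> V = Pi\<^sub>E (Dom \<sigma> - {V}) (Ran \<sigma>)"

text \<open>A function component maps each endogenous variable \<open>V\<close> to its law and each exogenous variable
  to \<open>None\<close>, so the set of endogenous variables is \<open>dom F\<close>. Laws are extensional functions, so equality
  of function components is equality of HOL functions.\<close>

type_synonym ('v, 'a) laws = "'v \<Rightarrow> (('v \<Rightarrow> 'a) \<Rightarrow> 'a) option"

text \<open>The parents of \<open>V\<close> are the arguments on which its law really depends (the non-dummy ones).\<close>

definition parents :: "('v, 'a) sig \<Rightarrow> ('v, 'a) laws \<Rightarrow> 'v \<Rightarrow> 'v set" where
  "parents \<sigma> F V = {X \<in> Dom \<sigma> - {V}. \<exists>f. F V = Some f \<and>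
     (\<exists>w\<in>other_values \<sigma> V. \<exists>w'\<in>other_values \<sigma> V.
        (\<forall>Z\<in>Dom \<sigma> - {V, X}. w Z = w' Z) \<and> f w \<noteq> f w')}"

definition causal_graph :: "('v, 'a) sig \<Rightarrow> ('v, 'a) laws \<Rightarrow> ('v \<times> 'v) set" where
  "causal_graph \<sigma> F = {(X, V). V \<in> dom F \<and> X \<in> parents \<sigma> F V}"

definition function_component :: "('v, 'a) sig \<Rightarrow> ('v, 'a) laws \<Rightarrow> bool" where
  "function_component \<sigma> F \<longleftrightarrow> dom F \<subseteq> Dom \<sigma> \<and>
     (\<forall>V f. F V = Some f \<longrightarrow> f \<in> other_values \<sigma> V \<rightarrow>\<^sub>E Ran \<sigma> V \<and>
        (\<exists>w\<in>other_values \<sigma> V. \<exists>w'\<in>other_values \<sigma> V. f w \<noteq> f w')) \<and>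
     acyclic (causal_graph \<sigma> F)"

definition compatible :: "('v, 'a) sig \<Rightarrow> ('v, 'a) laws \<Rightarrow> ('v \<Rightarrow> 'a) \<Rightarrow> bool" where
  "compatible \<sigma> F s \<longleftrightarrow> (\<forall>V f. F V = Some f \<longrightarrow> f (restrict s (Dom \<sigma> - {V})) = s V)"

type_synonym ('v, 'a) cmteam = "('v \<Rightarrow> 'a) multiset \<times> ('v, 'a) laws"

definition causal_multiteams :: "('v, 'a) sig \<Rightarrow> ('v, 'a) cmteam set" where
  "causal_multiteams \<sigma> = {(M, F). set_mset M \<subseteq> assignments \<sigma> \<and> function_component \<sigma> F \<and>
     (\<forall>s\<in>#M. compatible \<sigma> F s)}"

text \<open>An antecedent \<open>X\<^sub>1 = x\<^sub>1 \<and> \<dots> \<and> X\<^sub>k = x\<^sub>k\<close> is a list of pairs; it may repeat variables.\<close>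

definition consistent :: "('v \<times> 'a) list \<Rightarrow> bool" where
  "consistent xs \<longleftrightarrow> (\<forall>X x x'. (X, x) \<in> set xs \<and> (X, x') \<in> set xs \<longrightarrow> x = x')"

definition do_laws :: "('v, 'a) laws \<Rightarrow> ('v \<times> 'a) list \<Rightarrow> ('v, 'a) laws" where
  "do_laws F xs = F |` (- fst ` set xs)"

text \<open>Acyclicity of the causal graph makes the solution of the modified system of equations unique.\<close>

definition do_assignment ::
  "('v, 'a) sig \<Rightarrow> ('v, 'a) laws \<Rightarrow> ('v \<times> 'a) list \<Rightarrow> ('v \<Rightarrow> 'a) \<Rightarrow> ('v \<Rightarrow> 'a)" where
  "do_assignment \<sigma> F xs s = (THE t. t \<in> assignments \<sigma> \<and>
     (\<forall>(X, x)\<in>set xs. t X = x) \<and>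
     (\<forall>V\<in>Dom \<sigma> - dom F - fst ` set xs. t V = s V) \<and>
     compatible \<sigma> (do_laws F xs) t)"

definition intervene ::
  "('v, 'a) sig \<Rightarrow> ('v \<times> 'a) list \<Rightarrow> ('v, 'a) cmteam \<Rightarrow> ('v, 'a) cmteam" where
  "intervene \<sigma> xs T = (image_mset (do_assignment \<sigma> (snd T) xs) (fst T), do_laws (snd T) xs)"

datatype ('v, 'a) co =
    CEq 'v 'a
  | CNeq 'v 'a
  | CAnd "('v, 'a) co" "('v, 'a) co"
  | COr "('v, 'a) co" "('v, 'a) co"
  | CSel "('v, 'a) co" "('v, 'a) co"
  | CBox "('v \<times> 'a) list" "('v, 'a) co"

primrec co_formula :: "('v, 'a) sig \<Rightarrow> ('v, 'a) co \<Rightarrow> bool" where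
  "co_formula \<sigma> (CEq Y y) \<longleftrightarrow> Y \<in> Dom \<sigma> \<and> y \<in> Ran \<sigma> Y"
| "co_formula \<sigma> (CNeq Y y) \<longleftrightarrow> Y \<in> Dom \<sigma> \<and> y \<in> Ran \<sigma> Y"
| "co_formula \<sigma> (CAnd \<alpha> \<beta>) \<longleftrightarrow> co_formula \<sigma> \<alpha> \<and> co_formula \<sigma> \<beta>"
| "co_formula \<sigma> (COr \<alpha> \<beta>) \<longleftrightarrow> co_formula \<sigma> \<alpha> \<and> co_formula \<sigma> \<beta>"
| "co_formula \<sigma> (CSel \<alpha> \<beta>) \<longleftrightarrow> co_formula \<sigma> \<alpha> \<and> co_formula \<sigma> \<beta>"
| "co_formula \<sigma> (CBox xs \<alpha>) \<longleftrightarrow>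
     (\<forall>(X, x)\<in>set xs. X \<in> Dom \<sigma> \<and> x \<in> Ran \<sigma> X) \<and> co_formula \<sigma> \<alpha>"

text \<open>In the clause for tensor disjunction the two parts cover the multiteam and may overlap. For
  sets \<open>A\<close>, \<open>B\<close> of rows this says \<open>A \<union> B\<close> is the set of all rows, hence in terms of multiplicities
  \<open>M \<subseteq># M1 + M2\<close>.\<close>

primrec co_sat :: "('v, 'a) sig \<Rightarrow> ('v, 'a) co \<Rightarrow> ('v, 'a) cmteam \<Rightarrow> bool" where
  "co_sat \<sigma> (CEq Y y) T \<longleftrightarrow> (\<forall>s\<in>#fst T. s Y = y)"
| "co_sat \<sigma> (CNeq Y y) T \<longleftrightarrow> (\<forall>s\<in>#fst T. s Y \<noteq> y)"
| "co_sat \<sigma> (CAnd \<alpha> \<beta>) T \<longleftrightarrow> co_sat \<sigma> \<alpha> T \<and> co_sat \<sigma> \<beta> T"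
| "co_sat \<sigma> (COr \<alpha> \<beta>) T \<longleftrightarrow> (\<exists>M1 M2. M1 \<subseteq># fst T \<and> M2 \<subseteq># fst T \<and> fst T \<subseteq># M1 + M2 \<and>
     co_sat \<sigma> \<alpha> (M1, snd T) \<and> co_sat \<sigma> \<beta> (M2, snd T))"
| "co_sat \<sigma> (CSel \<alpha> \<beta>) T \<longleftrightarrow>
     co_sat \<sigma> \<beta> (filter_mset (\<lambda>s. co_sat \<sigma> \<alpha> ({#s#}, snd T)) (fst T), snd T)"
| "co_sat \<sigma> (CBox xs \<alpha>) T \<longleftrightarrow> (consistent xs \<longrightarrow> co_sat \<sigma> \<alpha> (intervene \<sigma> xs T))"

definition submultiteam ::
  "('v, 'a) sig \<Rightarrow> ('v, 'a) co \<Rightarrow> ('v, 'a) cmteam \<Rightarrow> ('v, 'a) cmteam" where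
  "submultiteam \<sigma> \<alpha> T = (filter_mset (\<lambda>s. co_sat \<sigma> \<alpha> ({#s#}, snd T)) (fst T), snd T)"

definition prob :: "('v, 'a) sig \<Rightarrow> ('v, 'a) cmteam \<Rightarrow> ('v, 'a) co \<Rightarrow> rat" where
  "prob \<sigma> T \<alpha> = of_nat (size (fst (submultiteam \<sigma> \<alpha> T))) / of_nat (size (fst T))"

datatype ('v, 'a) pco =
    PEq 'v 'a
  | PNeq 'v 'a
  | PrGe "('v, 'a) co" rat
  | PrGt "('v, 'a) co" rat
  | PrGePr "('v, 'a) co" "('v, 'a) co"
  | PrGtPr "('v, 'a) co" "('v, 'a) co"
  | PAnd "('v, 'a) pco" "('v, 'a) pco"
  | PDisj "('v, 'a) pco" "('v, 'a) pco"
  | PSel "('v, 'a) co" "('v, 'a) pco"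
  | PBox "('v \<times> 'a) list" "('v, 'a) pco"

primrec pco_formula :: "('v, 'a) sig \<Rightarrow> ('v, 'a) pco \<Rightarrow> bool" where
  "pco_formula \<sigma> (PEq Y y) \<longleftrightarrow> Y \<in> Dom \<sigma> \<and> y \<in> Ran \<sigma> Y"
| "pco_formula \<sigma> (PNeq Y y) \<longleftrightarrow> Y \<in> Dom \<sigma> \<and> y \<in> Ran \<sigma> Y"
| "pco_formula \<sigma> (PrGe \<alpha> \<epsilon>) \<longleftrightarrow> co_formula \<sigma> \<alpha> \<and> 0 \<le> \<epsilon> \<and> \<epsilon> \<le> 1"
| "pco_formula \<sigma> (PrGt \<alpha> \<epsilon>) \<longleftrightarrow> co_formula \<sigma> \<alpha> \<and> 0 \<le> \<epsilon> \<and> \<epsilon> \<le> 1"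
| "pco_formula \<sigma> (PrGePr \<alpha> \<beta>) \<longleftrightarrow> co_formula \<sigma> \<alpha> \<and> co_formula \<sigma> \<beta>"
| "pco_formula \<sigma> (PrGtPr \<alpha> \<beta>) \<longleftrightarrow> co_formula \<sigma> \<alpha> \<and> co_formula \<sigma> \<beta>"
| "pco_formula \<sigma> (PAnd \<phi> \<psi>) \<longleftrightarrow> pco_formula \<sigma> \<phi> \<and> pco_formula \<sigma> \<psi>"
| "pco_formula \<sigma> (PDisj \<phi> \<psi>) \<longleftrightarrow> pco_formula \<sigma> \<phi> \<and> pco_formula \<sigma> \<psi>"
| "pco_formula \<sigma> (PSel \<alpha> \<phi>) \<longleftrightarrow> co_formula \<sigma> \<alpha> \<and> pco_formula \<sigma> \<phi>"
| "pco_formula \<sigma> (PBox xs \<phi>) \<longleftrightarrow>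
     (\<forall>(X, x)\<in>set xs. X \<in> Dom \<sigma> \<and> x \<in> Ran \<sigma> X) \<and> pco_formula \<sigma> \<phi>"

primrec pco_sat :: "('v, 'a) sig \<Rightarrow> ('v, 'a) pco \<Rightarrow> ('v, 'a) cmteam \<Rightarrow> bool" where
  "pco_sat \<sigma> (PEq Y y) T \<longleftrightarrow> (\<forall>s\<in>#fst T. s Y = y)"
| "pco_sat \<sigma> (PNeq Y y) T \<longleftrightarrow> (\<forall>s\<in>#fst T. s Y \<noteq> y)"
| "pco_sat \<sigma> (PrGe \<alpha> \<epsilon>) T \<longleftrightarrow> fst T = {#} \<or> prob \<sigma> T \<alpha> \<ge> \<epsilon>"
| "pco_sat \<sigma> (PrGt \<alpha> \<epsilon>) T \<longleftrightarrow> fst T = {#} \<or> prob \<sigma> T \<alpha> > \<epsilon>"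
| "pco_sat \<sigma> (PrGePr \<alpha> \<beta>) T \<longleftrightarrow> fst T = {#} \<or> prob \<sigma> T \<alpha> \<ge> prob \<sigma> T \<beta>"
| "pco_sat \<sigma> (PrGtPr \<alpha> \<beta>) T \<longleftrightarrow> fst T = {#} \<or> prob \<sigma> T \<alpha> > prob \<sigma> T \<beta>"
| "pco_sat \<sigma> (PAnd \<phi> \<psi>) T \<longleftrightarrow> pco_sat \<sigma> \<phi> T \<and> pco_sat \<sigma> \<psi> T"
| "pco_sat \<sigma> (PDisj \<phi> \<psi>) T \<longleftrightarrow> pco_sat \<sigma> \<phi> T \<or> pco_sat \<sigma> \<psi> T"
| "pco_sat \<sigma> (PSel \<alpha> \<phi>) T \<longleftrightarrow> pco_sat \<sigma> \<phi> (submultiteam \<sigma> \<alpha> T)"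
| "pco_sat \<sigma> (PBox xs \<phi>) T \<longleftrightarrow> (consistent xs \<longrightarrow> pco_sat \<sigma> \<phi> (intervene \<sigma> xs T))"

primrec box_free :: "('v, 'a) co \<Rightarrow> bool" where
  "box_free (CEq Y y) \<longleftrightarrow> True"
| "box_free (CNeq Y y) \<longleftrightarrow> True"
| "box_free (CAnd \<alpha> \<beta>) \<longleftrightarrow> box_free \<alpha> \<and> box_free \<beta>"
| "box_free (COr \<alpha> \<beta>) \<longleftrightarrow> box_free \<alpha> \<and> box_free \<beta>"
| "box_free (CSel \<alpha> \<beta>) \<longleftrightarrow> box_free \<alpha> \<and> box_free \<beta>"
| "box_free (CBox xs \<alpha>) \<longleftrightarrow> False"

text \<open>Counterfactuals are excluded inside probabilistic atoms as well: \<open>Pr(X = 1 \<box>\<rightarrow> Y = 1) \<ge> 1\<close>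
  depends on the laws, so with it P would not be closed under change of laws. Selective implication
  inside an atom is harmless there (it is the material conditional).\<close>

primrec in_P :: "('v, 'a) pco \<Rightarrow> bool" where
  "in_P (PEq Y y) \<longleftrightarrow> True"
| "in_P (PNeq Y y) \<longleftrightarrow> True"
| "in_P (PrGe \<alpha> \<epsilon>) \<longleftrightarrow> box_free \<alpha>"
| "in_P (PrGt \<alpha> \<epsilon>) \<longleftrightarrow> box_free \<alpha>"
| "in_P (PrGePr \<alpha> \<beta>) \<longleftrightarrow> box_free \<alpha> \<and> box_free \<beta>"
| "in_P (PrGtPr \<alpha> \<beta>) \<longleftrightarrow> box_free \<alpha> \<and> box_free \<beta>"
| "in_P (PAnd \<phi> \<psi>) \<longleftrightarrow> in_P \<phi> \<and> in_P \<psi>"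
| "in_P (PDisj \<phi> \<psi>) \<longleftrightarrow> in_P \<phi> \<and> in_P \<psi>"
| "in_P (PSel \<alpha> \<phi>) \<longleftrightarrow> False"
| "in_P (PBox xs \<phi>) \<longleftrightarrow> False"

primrec comparison_free :: "('v, 'a) pco \<Rightarrow> bool" where
  "comparison_free (PEq Y y) \<longleftrightarrow> True"
| "comparison_free (PNeq Y y) \<longleftrightarrow> True"
| "comparison_free (PrGe \<alpha> \<epsilon>) \<longleftrightarrow> True"
| "comparison_free (PrGt \<alpha> \<epsilon>) \<longleftrightarrow> True"
| "comparison_free (PrGePr \<alpha> \<beta>) \<longleftrightarrow> False"
| "comparison_free (PrGtPr \<alpha> \<beta>) \<longleftrightarrow> False"
| "comparison_free (PAnd \<phi> \<psi>) \<longleftrightarrow> comparison_free \<phi> \<and> comparison_free \<psi>"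
| "comparison_free (PDisj \<phi> \<psi>) \<longleftrightarrow> comparison_free \<phi> \<and> comparison_free \<psi>"
| "comparison_free (PSel \<alpha> \<phi>) \<longleftrightarrow> comparison_free \<phi>"
| "comparison_free (PBox xs \<phi>) \<longleftrightarrow> comparison_free \<phi>"

definition P_lang :: "('v, 'a) sig \<Rightarrow> ('v, 'a) pco set" where
  "P_lang \<sigma> = {\<phi>. pco_formula \<sigma> \<phi> \<and> in_P \<phi>}"

definition P_minus_lang :: "('v, 'a) sig \<Rightarrow> ('v, 'a) pco set" where
  "P_minus_lang \<sigma> = {\<phi> \<in> P_lang \<sigma>. comparison_free \<phi>}"

definition definable_in :: "('v, 'a) sig \<Rightarrow> ('v, 'a) pco set \<Rightarrow> ('v, 'a) cmteam set \<Rightarrow> bool" where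
  "definable_in \<sigma> L K \<longleftrightarrow> (\<exists>\<phi>\<in>L. K = {T \<in> causal_multiteams \<sigma>. pco_sat \<sigma> \<phi> T})"

definition empty_multiteam_property :: "('v, 'a) sig \<Rightarrow> ('v, 'a) cmteam set \<Rightarrow> bool" where
  "empty_multiteam_property \<sigma> K \<longleftrightarrow> (\<forall>F. ({#}, F) \<in> causal_multiteams \<sigma> \<longrightarrow> ({#}, F) \<in> K)"

definition frequency :: "('v \<Rightarrow> 'a) multiset \<Rightarrow> ('v \<Rightarrow> 'a) \<Rightarrow> rat" where
  "frequency M s = of_nat (count M s) / of_nat (size M)"

definition closed_under_rescaling :: "('v, 'a) sig \<Rightarrow> ('v, 'a) cmteam set \<Rightarrow> bool" where
  "closed_under_rescaling \<sigma> K \<longleftrightarrow>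
     (\<forall>M M' F. (M, F) \<in> K \<and> (M', F) \<in> causal_multiteams \<sigma> \<and>
        (M = {#} \<and> M' = {#} \<or>
         M \<noteq> {#} \<and> M' \<noteq> {#} \<and> (\<forall>s\<in>assignments \<sigma>. frequency M s = frequency M' s)) \<longrightarrow>
        (M', F) \<in> K)"

text \<open>The new function component must be compatible with the multiteam: otherwise the pair is not a
  causal multiteam and cannot belong to a class of causal multiteams.\<close>

definition closed_under_change_of_laws :: "('v, 'a) sig \<Rightarrow> ('v, 'a) cmteam set \<Rightarrow> bool" where
  "closed_under_change_of_laws \<sigma> K \<longleftrightarrow>
     (\<forall>M F G. (M, F) \<in> K \<and> (M, G) \<in> causal_multiteams \<sigma> \<longrightarrow> (M, G) \<in> K)"

text \<open>Vectors are indexed by the assignments themselves instead of by positions in an enumeration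
  of them. Frequencies are rational, so the simplex is that of rational vectors: a union of real
  polyhedra containing all rational points of the simplex would also contain irrational ones.\<close>

definition probability_vector ::
  "('v, 'a) sig \<Rightarrow> ('v \<Rightarrow> 'a) multiset \<Rightarrow> ('v \<Rightarrow> 'a) \<Rightarrow> rat" where
  "probability_vector \<sigma> M = restrict (frequency M) (assignments \<sigma>)"

definition probability_set ::
  "('v, 'a) sig \<Rightarrow> ('v, 'a) cmteam set \<Rightarrow> (('v \<Rightarrow> 'a) \<Rightarrow> rat) set" where
  "probability_set \<sigma> K = {probability_vector \<sigma> M | M F. (M, F) \<in> K \<and> M \<noteq> {#}}"

definition simplex :: "('v, 'a) sig \<Rightarrow> (('v \<Rightarrow> 'a) \<Rightarrow> rat) set" where
  "simplex \<sigma> = {e \<in> assignments \<sigma> \<rightarrow>\<^sub>E {0..}. (\<Sum>s\<in>assignments \<sigma>. e s) = 1}"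

datatype ineq_rel = Ge | Le | Gt | Lt

primrec rel_holds :: "ineq_rel \<Rightarrow> rat \<Rightarrow> rat \<Rightarrow> bool" where
  "rel_holds Ge x y \<longleftrightarrow> x \<ge> y"
| "rel_holds Le x y \<longleftrightarrow> x \<le> y"
| "rel_holds Gt x y \<longleftrightarrow> x > y"
| "rel_holds Lt x y \<longleftrightarrow> x < y"

datatype ('v, 'a) ineq =
  Ineq (coeffs: "('v \<Rightarrow> 'a) \<Rightarrow> rat") (relation: ineq_rel) (bound: rat)

definition ineq_holds :: "('v, 'a) sig \<Rightarrow> (('v \<Rightarrow> 'a) \<Rightarrow> rat) \<Rightarrow> ('v, 'a) ineq \<Rightarrow> bool" where
  "ineq_holds \<sigma> e I \<longleftrightarrow>
     rel_holds (relation I) (\<Sum>s\<in>assignments \<sigma>. coeffs I s * e s) (bound I)"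

definition monic_ineq :: "('v, 'a) sig \<Rightarrow> ('v, 'a) ineq \<Rightarrow> bool" where
  "monic_ineq \<sigma> I \<longleftrightarrow> (\<forall>s\<in>assignments \<sigma>. coeffs I s \<in> {0, 1})"

text \<open>An inequality in which both signs occur is required to be homogeneous. Without that clause the
  inequality \<open>\<epsilon>\<^sub>1 - \<epsilon>\<^sub>2 \<ge> 1/2\<close> over a signature with three assignments would be signed monic, yet no
  Boolean combination of comparisons of probabilities with constants and with each other defines it.\<close>

definition signed_monic_ineq :: "('v, 'a) sig \<Rightarrow> ('v, 'a) ineq \<Rightarrow> bool" where
  "signed_monic_ineq \<sigma> I \<longleftrightarrow>
     (\<forall>s\<in>assignments \<sigma>. coeffs I s \<in> {0, 1, -1}) \<and>
     ((\<exists>s\<in>assignments \<sigma>. coeffs I s = 1) \<and> (\<exists>s\<in>assignments \<sigma>. coeffs I s = -1) \<longrightarrow> bound I = 0)"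

definition defined_by :: "('v, 'a) sig \<Rightarrow> ('v, 'a) ineq set \<Rightarrow> (('v \<Rightarrow> 'a) \<Rightarrow> rat) set" where
  "defined_by \<sigma> S = {e \<in> simplex \<sigma>. \<forall>I\<in>S. ineq_holds \<sigma> e I}"

definition finite_union_of_systems ::
  "('v, 'a) sig \<Rightarrow> (('v, 'a) ineq \<Rightarrow> bool) \<Rightarrow> (('v \<Rightarrow> 'a) \<Rightarrow> rat) set \<Rightarrow> bool" where
  "finite_union_of_systems \<sigma> Q A \<longleftrightarrow>
     (\<exists>\<S>. finite \<S> \<and> (\<forall>S\<in>\<S>. finite S \<and> (\<forall>I\<in>S. Q I)) \<and> A = (\<Union>S\<in>\<S>. defined_by \<sigma> S))"

definition monic :: "('v, 'a) sig \<Rightarrow> ('v, 'a) cmteam set \<Rightarrow> bool" where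
  "monic \<sigma> K \<longleftrightarrow> finite_union_of_systems \<sigma> (monic_ineq \<sigma>) (probability_set \<sigma> K)"

definition signed_monic :: "('v, 'a) sig \<Rightarrow> ('v, 'a) cmteam set \<Rightarrow> bool" where
  "signed_monic \<sigma> K \<longleftrightarrow> finite_union_of_systems \<sigma> (signed_monic_ineq \<sigma>) (probability_set \<sigma> K)"

end

theory Submission
  imports Defs
begin

text \<open>On a nonempty multiteam a box-free probabilistic atom only sees the masses of sets of assignments,
  and every set of assignments is the extension of some box-free formula. Hence atoms and (signed) monic
  inequalities express the same conditions on the probability vector, conjunction and global disjunction
  matching intersections and unions. Every rational vector of the simplex is realised by a multiteam with
  no laws at all, and the closure properties say exactly that a class is determined by its probability
  set.\<close>

section \<open>Formulas, classes and sets of probability vectors\<close>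

definition truth_class :: "('v, 'a) sig \<Rightarrow> ('v, 'a) pco \<Rightarrow> ('v, 'a) cmteam set" where
  "truth_class \<sigma> \<phi> = {T \<in> causal_multiteams \<sigma>. pco_sat \<sigma> \<phi> T}"

text \<open>Empty multiteams have no probability vector and satisfy every atom, so they always
  belong. The laws enter only through membership in \<open>causal_multiteams\<close>.\<close>

definition team_class :: "('v, 'a) sig \<Rightarrow> (('v \<Rightarrow> 'a) \<Rightarrow> rat) set \<Rightarrow> ('v, 'a) cmteam set" where
  "team_class \<sigma> A = {T \<in> causal_multiteams \<sigma>. fst T = {#} \<or> probability_vector \<sigma> (fst T) \<in> A}"

definition expressible ::
  "('v, 'a) sig \<Rightarrow> ('v, 'a) pco set \<Rightarrow> (('v \<Rightarrow> 'a) \<Rightarrow> rat) set \<Rightarrow> bool" where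
  "expressible \<sigma> L A \<longleftrightarrow> (\<exists>\<phi>\<in>L. truth_class \<sigma> \<phi> = team_class \<sigma> A)"

text \<open>The laws \<open>Map.empty\<close> are a neutral choice: they are compatible with every
  assignment, and for box-free \<alpha> the choice of laws does not affect truth.\<close>

definition extension :: "('v, 'a) sig \<Rightarrow> ('v, 'a) co \<Rightarrow> ('v \<Rightarrow> 'a) set" where
  "extension \<sigma> \<alpha> = {s \<in> assignments \<sigma>. co_sat \<sigma> \<alpha> ({#s#}, Map.empty)}"

lemma finite_assignments: "signature \<sigma> \<Longrightarrow> finite (assignments \<sigma>)"
  unfolding signature_def assignments_def by (auto intro: finite_PiE)

section \<open>Semantics of causal formulas\<close>

text \<open>Flatness. Selection and intervention act row by row, so only tensor disjunction needs an
  argument: a suitable cover is found by testing each row.\<close>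

lemma co_sat_flat: "co_sat \<sigma> \<alpha> (M, F) \<longleftrightarrow> (\<forall>s\<in>#M. co_sat \<sigma> \<alpha> ({#s#}, F))"
proof (induction \<alpha> arbitrary: M F)
  case (CAnd \<alpha> \<beta>)
  show ?case
    by (auto simp: CAnd.IH(1)[of M] CAnd.IH(2)[of M])
next
  case (COr \<alpha> \<beta>)
  \<comment> \<open>Stated for every \<open>N\<close>, since the two sides of flatness involve the
    disjunction on \<open>M\<close> and on singletons.\<close>
  have or: "co_sat \<sigma> (COr \<alpha> \<beta>) (N, F) \<longleftrightarrow>
      (\<forall>s\<in>#N. co_sat \<sigma> \<alpha> ({#s#}, F) \<or> co_sat \<sigma> \<beta> ({#s#}, F))" for N
  proof
    assume "co_sat \<sigma> (COr \<alpha> \<beta>) (N, F)"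
    then obtain M1 M2 where "N \<subseteq># M1 + M2" and M1: "co_sat \<sigma> \<alpha> (M1, F)" and M2: "co_sat \<sigma> \<beta> (M2, F)"
      by auto
    moreover from this(1) have "s \<in># M1 \<or> s \<in># M2" if "s \<in># N" for s
      using that by (meson mset_subset_eqD union_iff)
    ultimately show "\<forall>s\<in>#N. co_sat \<sigma> \<alpha> ({#s#}, F) \<or> co_sat \<sigma> \<beta> ({#s#}, F)"
      using COr.IH(1)[of M1 F] COr.IH(2)[of M2 F] by blast
  next
    assume *: "\<forall>s\<in>#N. co_sat \<sigma> \<alpha> ({#s#}, F) \<or> co_sat \<sigma> \<beta> ({#s#}, F)"
    \<comment> \<open>The cover splits \<open>N\<close> into the rows satisfying \<alpha> and the
      others, which satisfy \<beta> by assumption.\<close>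
    define M1 where "M1 = filter_mset (\<lambda>s. co_sat \<sigma> \<alpha> ({#s#}, F)) N"
    define M2 where "M2 = filter_mset (\<lambda>s. \<not> co_sat \<sigma> \<alpha> ({#s#}, F)) N"
    have "co_sat \<sigma> \<alpha> (M1, F)" "co_sat \<sigma> \<beta> (M2, F)"
      unfolding COr.IH(1)[of M1] COr.IH(2)[of M2] using * by (auto simp: M1_def M2_def)
    moreover have "N = M1 + M2" unfolding M1_def M2_def by (rule multiset_partition)
    moreover from this have "M1 \<subseteq># N" "M2 \<subseteq># N" by simp_all
    ultimately show "co_sat \<sigma> (COr \<alpha> \<beta>) (N, F)"
      unfolding co_sat.simps by - (rule exI[of _ M1], rule exI[of _ M2], simp)
  qed
  show ?case unfolding or by simp
next
  case (CSel \<alpha> \<beta>)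
  show ?case
    by (auto simp: CSel.IH(2)[of "filter_mset _ _"] CSel.IH(2)[of "{#}"])
next
  case (CBox xs \<alpha>)
  show ?case
    by (simp add: intervene_def CBox.IH[of "image_mset _ _"])
qed simp_all

lemma co_sat_empty: "co_sat \<sigma> \<alpha> ({#}, F)"
  by (simp add: co_sat_flat[of _ _ "{#}"])

text \<open>Some part of a cover must contain the only row; conversely, the other part may be empty,
  where every formula holds.\<close>

lemma co_sat_COr_single:
  "co_sat \<sigma> (COr \<alpha> \<beta>) ({#s#}, F) \<longleftrightarrow> co_sat \<sigma> \<alpha> ({#s#}, F) \<or> co_sat \<sigma> \<beta> ({#s#}, F)"
proof
  assume "co_sat \<sigma> (COr \<alpha> \<beta>) ({#s#}, F)"
  then obtain M1 M2 where "{#s#} \<subseteq># M1 + M2" and M1: "co_sat \<sigma> \<alpha> (M1, F)" and M2: "co_sat \<sigma> \<beta> (M2, F)"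
    by auto
  moreover from this(1) have "s \<in># M1 \<or> s \<in># M2"
    by (meson mset_subset_eqD union_iff union_single_eq_member single_subset_iff)
  ultimately show "co_sat \<sigma> \<alpha> ({#s#}, F) \<or> co_sat \<sigma> \<beta> ({#s#}, F)"
    using co_sat_flat[of \<sigma> \<alpha> M1 F] co_sat_flat[of \<sigma> \<beta> M2 F] by blast
next
  assume "co_sat \<sigma> \<alpha> ({#s#}, F) \<or> co_sat \<sigma> \<beta> ({#s#}, F)"
  then show "co_sat \<sigma> (COr \<alpha> \<beta>) ({#s#}, F)"
  proof
    assume "co_sat \<sigma> \<alpha> ({#s#}, F)"
    then show ?thesis
      unfolding co_sat.simps by - (rule exI[of _ "{#s#}"], rule exI[of _ "{#}"], simp add: co_sat_empty)
  next
    assume "co_sat \<sigma> \<beta> ({#s#}, F)"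
    then show ?thesis
      unfolding co_sat.simps by - (rule exI[of _ "{#}"], rule exI[of _ "{#s#}"], simp add: co_sat_empty)
  qed
qed

text \<open>Only counterfactuals consult the laws. Selective implication merely passes them on to
  the singletons on which its antecedent is tested.\<close>

lemma co_sat_box_free_laws: "box_free \<alpha> \<Longrightarrow> co_sat \<sigma> \<alpha> (M, F) \<longleftrightarrow> co_sat \<sigma> \<alpha> (M, G)"
proof (induction \<alpha> arbitrary: M)
  case (CSel \<alpha> \<beta>)
  then have "co_sat \<sigma> \<alpha> ({#s#}, F) = co_sat \<sigma> \<alpha> ({#s#}, G)" for s by simp
  with CSel show ?case by simp
qed auto

lemma ex_literal_conjunction:
  assumes "signature \<sigma>" "s \<in> assignments \<sigma>"
  shows "\<exists>\<alpha>. co_formula \<sigma> \<alpha> \<and> box_free \<alpha> \<and> extension \<sigma> \<alpha> = {s}"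
proof -
  \<comment> \<open>The induction starts from one variable, since the syntax has no constant for
    truth; \<open>Dom \<sigma>\<close> is nonempty.\<close>
  have "\<exists>\<alpha>. co_formula \<sigma> \<alpha> \<and> box_free \<alpha> \<and>
      extension \<sigma> \<alpha> = {t \<in> assignments \<sigma>. \<forall>X\<in>D. t X = s X}"
    if "finite D" "D \<noteq> {}" "D \<subseteq> Dom \<sigma>" for D
    using that
  proof (induction D rule: finite_ne_induct)
    case (singleton X)
    with assms(2) show ?case
      by (intro exI[of _ "CEq X (s X)"]) (auto simp: extension_def assignments_def)
  next
    case (insert X D)
    then obtain \<alpha> where "co_formula \<sigma> \<alpha>" "box_free \<alpha>"
      "extension \<sigma> \<alpha> = {t \<in> assignments \<sigma>. \<forall>X\<in>D. t X = s X}" by auto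
    with insert.prems assms(2) show ?case
      by (intro exI[of _ "CAnd (CEq X (s X)) \<alpha>"]) (auto simp: extension_def assignments_def)
  qed
  from this[of "Dom \<sigma>"] assms obtain \<alpha> where \<alpha>: "co_formula \<sigma> \<alpha>" "box_free \<alpha>"
    "extension \<sigma> \<alpha> = {t \<in> assignments \<sigma>. \<forall>X\<in>Dom \<sigma>. t X = s X}"
    unfolding signature_def by auto
  \<comment> \<open>Assignments are extensional, so agreement on the domain is equality.\<close>
  have "{t \<in> assignments \<sigma>. \<forall>X\<in>Dom \<sigma>. t X = s X} = {s}"
    using assms(2) by (auto simp: assignments_def intro: PiE_ext)
  with \<alpha> show ?thesis by auto
qed

text \<open>Each assignment is described by a conjunction of literals, and tensor disjunction joins
  the descriptions; a contradiction covers the empty set.\<close>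

lemma ex_co_extension:
  assumes \<sigma>: "signature \<sigma>" and "A \<subseteq> assignments \<sigma>"
  obtains \<alpha> where "co_formula \<sigma> \<alpha>" "box_free \<alpha>" "extension \<sigma> \<alpha> = A"
proof -
  have "finite A" using assms finite_assignments finite_subset by blast
  then have "\<exists>\<alpha>. co_formula \<sigma> \<alpha> \<and> box_free \<alpha> \<and> extension \<sigma> \<alpha> = A"
    using assms(2)
  proof (induction A rule: finite_induct)
    case empty
    from \<sigma> obtain X x where "X \<in> Dom \<sigma>" "x \<in> Ran \<sigma> X"
      unfolding signature_def by blast
    then show ?case
      by (intro exI[of _ "CAnd (CEq X x) (CNeq X x)"]) (auto simp: extension_def)
  next
    case (insert s A)
    then obtain \<alpha> where \<alpha>: "co_formula \<sigma> \<alpha>" "box_free \<alpha>" "extension \<sigma> \<alpha> = A" by auto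
    from ex_literal_conjunction[OF \<sigma>, of s] insert.prems obtain \<beta>
      where \<beta>: "co_formula \<sigma> \<beta>" "box_free \<beta>" "extension \<sigma> \<beta> = {s}" by auto
    have "extension \<sigma> (COr \<beta> \<alpha>) = extension \<sigma> \<beta> \<union> extension \<sigma> \<alpha>"
      unfolding extension_def co_sat_COr_single by blast
    with \<alpha> \<beta> show ?case by (intro exI[of _ "COr \<beta> \<alpha>"]) auto
  qed
  then show thesis using that by blast
qed

section \<open>Probability vectors\<close>

text \<open>Adding frequencies counts rows: assignments that do not occur contribute 0, and the
  inclusion guarantees that no row is missed.\<close>

lemma sum_probability_vector:
  assumes "signature \<sigma>" "set_mset M \<subseteq> assignments \<sigma>"
  shows "(\<Sum>s\<in>{s \<in> assignments \<sigma>. P s}. probability_vector \<sigma> M s) =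
    of_nat (size (filter_mset P M)) / of_nat (size M)"
proof -
  have "(\<Sum>s\<in>{s \<in> assignments \<sigma>. P s}. probability_vector \<sigma> M s) =
      of_nat (\<Sum>s\<in>{s \<in> assignments \<sigma>. P s}. count M s) / of_nat (size M)"
    by (simp add: probability_vector_def frequency_def sum_divide_distrib)
  also have "(\<Sum>s\<in>{s \<in> assignments \<sigma>. P s}. count M s) = size (filter_mset P M)"
    unfolding size_multiset_overloaded_eq
    using assms finite_assignments[OF assms(1)]
    by (intro sum.mono_neutral_cong_right) auto
  finally show ?thesis .
qed

text \<open>The bridge from semantics to geometry: with box-free arguments, atoms become linear
  conditions on the vector, independent of the laws.\<close>

lemma prob_box_free:
  assumes "signature \<sigma>" "(M, F) \<in> causal_multiteams \<sigma>" "box_free \<alpha>"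
  shows "prob \<sigma> (M, F) \<alpha> = sum (probability_vector \<sigma> M) (extension \<sigma> \<alpha>)"
proof -
  have "set_mset M \<subseteq> assignments \<sigma>" using assms(2) by (simp add: causal_multiteams_def)
  moreover have "co_sat \<sigma> \<alpha> ({#s#}, F) = co_sat \<sigma> \<alpha> ({#s#}, Map.empty)" for s
    using assms(3) by (rule co_sat_box_free_laws)
  ultimately show ?thesis
    unfolding extension_def using assms(1)
    by (simp add: sum_probability_vector prob_def submultiteam_def)
qed

lemma probability_vector_simplex:
  assumes "signature \<sigma>" "(M, F) \<in> causal_multiteams \<sigma>" "M \<noteq> {#}"
  shows "probability_vector \<sigma> M \<in> simplex \<sigma>"
proof -
  have "set_mset M \<subseteq> assignments \<sigma>" using assms(2) by (simp add: causal_multiteams_def)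
  from sum_probability_vector[OF assms(1) this, of "\<lambda>_. True"] assms(3)
  have "sum (probability_vector \<sigma> M) (assignments \<sigma>) = 1" by simp
  moreover have "probability_vector \<sigma> M \<in> assignments \<sigma> \<rightarrow>\<^sub>E {0..}"
    by (auto simp: probability_vector_def frequency_def)
  ultimately show ?thesis by (simp add: simplex_def)
qed

text \<open>The product of the denominators works. Nonnegativity makes the scaled values natural
  numbers, fit to serve as multiplicities.\<close>

lemma ex_common_denominator:
  fixes e :: "'b \<Rightarrow> rat"
  assumes "finite A" "\<And>s. s \<in> A \<Longrightarrow> 0 \<le> e s"
  shows "\<exists>N>0. \<forall>s\<in>A. \<exists>k::nat. of_nat N * e s = of_nat k"
  using assms
proof (induction A rule: finite_induct)
  case empty
  show ?case by (intro exI[of _ 1]) simp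
next
  case (insert s A)
  then obtain N where N: "N > 0" "\<forall>s\<in>A. \<exists>k::nat. of_nat N * e s = of_nat k" by auto
  obtain a b where ab: "e s = Fract a b" "b > 0" by (cases "e s")
  have "0 \<le> e s" using insert.prems by simp
  with ab have "0 \<le> a" by (simp add: zero_le_Fract_iff)
  with ab have s: "of_nat (nat b) * e s = of_nat (nat a)"
    by (simp add: Fract_of_int_quotient)
  have "\<exists>k::nat. of_nat (nat b * N) * e t = of_nat k" if t: "t \<in> insert s A" for t
  proof (cases "t = s")
    case True
    then have "of_nat (nat b * N) * e t = of_nat (N * nat a)"
      using s by (simp add: ac_simps)
    then show ?thesis by blast
  next
    case False
    with N(2) t obtain k :: nat where "of_nat N * e t = of_nat k" by auto
    then have "of_nat (nat b * N) * e t = of_nat (nat b * k)" by (simp add: ac_simps)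
    then show ?thesis by blast
  qed
  moreover have "nat b * N > 0" using ab(2) N(1) by simp
  ultimately show ?case by blast
qed

lemma empty_laws_causal_multiteam:
  "set_mset M \<subseteq> assignments \<sigma> \<Longrightarrow> (M, Map.empty) \<in> causal_multiteams \<sigma>"
  by (simp add: causal_multiteams_def function_component_def causal_graph_def compatible_def acyclic_def)

text \<open>Clear denominators and use the scaled coordinates as multiplicities. Without laws,
  compatibility is vacuous.\<close>

lemma ex_multiteam_of_simplex:
  assumes \<sigma>: "signature \<sigma>" and e: "e \<in> simplex \<sigma>"
  obtains M where "(M, Map.empty) \<in> causal_multiteams \<sigma>" "M \<noteq> {#}" "probability_vector \<sigma> M = e"
proof -
  let ?A = "assignments \<sigma>"
  have fin: "finite ?A" using \<sigma> by (rule finite_assignments)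
  have nn: "0 \<le> e s" if "s \<in> ?A" for s using e that by (auto simp: simplex_def)
  obtain N k where N: "N > 0" and k: "\<And>s. s \<in> ?A \<Longrightarrow> of_nat N * e s = of_nat (k s :: nat)"
    using ex_common_denominator[of ?A e, OF fin nn] by metis
  define M where "M = (\<Sum>s\<in>?A. replicate_mset (k s) s)"
  have cnt: "count M s = (if s \<in> ?A then k s else 0)" for s
    using fin by (simp add: M_def count_sum sum.delta')
  \<comment> \<open>The coordinates of \<open>e\<close> add up to 1, so the multiplicities add up to
    \<open>N\<close>, and dividing by the size gives back \<open>e\<close>.\<close>
  have "of_nat (size M) = (of_nat (\<Sum>s\<in>?A. k s) :: rat)"
    by (simp add: M_def size_multiset_sum)
  also have "\<dots> = (\<Sum>s\<in>?A. of_nat N * e s)" by (simp add: k)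
  also have "\<dots> = of_nat N" using e by (simp add: sum_distrib_left[symmetric] simplex_def)
  finally have size: "size M = N" by simp
  have "probability_vector \<sigma> M = e"
  proof (rule PiE_ext)
    show "probability_vector \<sigma> M \<in> ?A \<rightarrow>\<^sub>E UNIV" by (simp add: probability_vector_def)
    show "e \<in> ?A \<rightarrow>\<^sub>E UNIV" using e by (auto simp: simplex_def PiE_def)
    fix s assume "s \<in> ?A"
    with N show "probability_vector \<sigma> M s = e s"
      by (simp add: probability_vector_def frequency_def cnt size k[symmetric])
  qed
  moreover have "M \<noteq> {#}" using size N by auto
  moreover have "set_mset M \<subseteq> ?A"
    using cnt by (metis count_eq_zero_iff subsetI)
  ultimately show thesis using that empty_laws_causal_multiteam by blast
qed

section \<open>Classes determined by their probability set\<close>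

text \<open>Every point of the simplex is realised by a multiteam, so passing from \<open>A\<close>
  to its class loses no information.\<close>

lemma probability_set_team_class:
  assumes "signature \<sigma>" "A \<subseteq> simplex \<sigma>"
  shows "probability_set \<sigma> (team_class \<sigma> A) = A"
proof
  show "probability_set \<sigma> (team_class \<sigma> A) \<subseteq> A"
    by (auto simp: probability_set_def team_class_def)
  show "A \<subseteq> probability_set \<sigma> (team_class \<sigma> A)"
  proof
    fix e assume "e \<in> A"
    with assms obtain M where "(M, Map.empty) \<in> causal_multiteams \<sigma>" "M \<noteq> {#}" "probability_vector \<sigma> M = e"
      using ex_multiteam_of_simplex by (metis subsetD)
    with \<open>e \<in> A\<close> show "e \<in> probability_set \<sigma> (team_class \<sigma> A)"
      unfolding probability_set_def team_class_def by force
  qed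
qed

lemma probability_vector_eq_iff:
  "probability_vector \<sigma> M = probability_vector \<sigma> M' \<longleftrightarrow>
    (\<forall>s\<in>assignments \<sigma>. frequency M s = frequency M' s)"
  unfolding probability_vector_def by (metis restrict_apply' restrict_ext)

text \<open>An assignment occurs exactly when its frequency is nonzero. This matters because
  compatibility with laws depends only on which assignments occur.\<close>

lemma set_mset_eq_of_probability_vector_eq:
  assumes "set_mset M \<subseteq> assignments \<sigma>" "set_mset M' \<subseteq> assignments \<sigma>" "M \<noteq> {#}" "M' \<noteq> {#}"
    and "probability_vector \<sigma> M = probability_vector \<sigma> M'"
  shows "set_mset M = set_mset M'"
proof -
  have "s \<in># M \<longleftrightarrow> s \<in># M'" if "s \<in> assignments \<sigma>" for s
  proof -
    have "frequency M s = frequency M' s"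
      using assms(5) that by (simp add: probability_vector_eq_iff)
    then have "count M s = 0 \<longleftrightarrow> count M' s = 0"
      using assms(3,4) by (auto simp: frequency_def)
    then show ?thesis by (simp add: count_eq_zero_iff)
  qed
  with assms(1,2) show ?thesis by blast
qed

text \<open>Given a member of \<open>K\<close> with the same vector as \<open>(M, F)\<close>, first
  change its laws to \<open>F\<close>, then rescale it to \<open>M\<close>. The order matters:
  rescaling keeps the laws fixed.\<close>

lemma closed_class_iff:
  assumes K: "K \<subseteq> causal_multiteams \<sigma>"
  shows "empty_multiteam_property \<sigma> K \<and> closed_under_change_of_laws \<sigma> K \<and> closed_under_rescaling \<sigma> K
    \<longleftrightarrow> K = team_class \<sigma> (probability_set \<sigma> K)" (is "?closed \<longleftrightarrow> _")
proof
  assume ?closed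
  then have empty: "\<And>F. ({#}, F) \<in> causal_multiteams \<sigma> \<Longrightarrow> ({#}, F) \<in> K"
    and laws: "\<And>M F G. (M, F) \<in> K \<Longrightarrow> (M, G) \<in> causal_multiteams \<sigma> \<Longrightarrow> (M, G) \<in> K"
    and rescale: "\<And>M M' F. (M, F) \<in> K \<Longrightarrow> (M', F) \<in> causal_multiteams \<sigma> \<Longrightarrow> M \<noteq> {#} \<Longrightarrow> M' \<noteq> {#} \<Longrightarrow>
      probability_vector \<sigma> M = probability_vector \<sigma> M' \<Longrightarrow> (M', F) \<in> K"
    unfolding empty_multiteam_property_def closed_under_change_of_laws_def closed_under_rescaling_def
      probability_vector_eq_iff by blast+
  show "K = team_class \<sigma> (probability_set \<sigma> K)"
  proof
    show "K \<subseteq> team_class \<sigma> (probability_set \<sigma> K)"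
      using K unfolding team_class_def probability_set_def by force
    show "team_class \<sigma> (probability_set \<sigma> K) \<subseteq> K"
    proof
      fix T assume T: "T \<in> team_class \<sigma> (probability_set \<sigma> K)"
      obtain M F where [simp]: "T = (M, F)" by (cases T)
      have MF: "(M, F) \<in> causal_multiteams \<sigma>" using T by (simp add: team_class_def)
      show "T \<in> K"
      proof (cases "M = {#}")
        case True
        with MF empty show ?thesis by simp
      next
        case False
        with T obtain M' F' where M': "(M', F') \<in> K" "M' \<noteq> {#}"
          "probability_vector \<sigma> M' = probability_vector \<sigma> M"
          by (auto simp: team_class_def probability_set_def)
        have "(M', F') \<in> causal_multiteams \<sigma>" using M' K by blast
        then have "set_mset M' = set_mset M"
          using MF M' False
          by (intro set_mset_eq_of_probability_vector_eq[of _ \<sigma>]) (auto simp: causal_multiteams_def)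
        \<comment> \<open>The intermediate pair is legal because \<open>M'\<close> has the same rows
          as \<open>M\<close>, which are compatible with \<open>F\<close>.\<close>
        with MF have "(M', F) \<in> causal_multiteams \<sigma>" by (simp add: causal_multiteams_def)
        with M'(1) have "(M', F) \<in> K" by (rule laws)
        from rescale[OF this MF M'(2) False M'(3)] show ?thesis by simp
      qed
    qed
  qed
next
  assume *: "K = team_class \<sigma> (probability_set \<sigma> K)"
  \<comment> \<open>Naming the set removes \<open>K\<close> from the right-hand side; any class of
    the form \<open>team_class \<sigma> A\<close> has the closure properties.\<close>
  define A where "A = probability_set \<sigma> K"
  have "K = team_class \<sigma> A" using * by (simp add: A_def)
  then show ?closed
    unfolding empty_multiteam_property_def closed_under_change_of_laws_def closed_under_rescaling_def
      probability_vector_eq_iff[symmetric] by (auto simp: team_class_def)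
qed

section \<open>Atoms and inequalities\<close>

text \<open>Disposes of empty multiteams once for all atoms. Membership in the simplex is supplied
  because the sets \<open>A\<close> of the atoms are cut out of it.\<close>

lemma truth_class_eqI:
  assumes "signature \<sigma>"
    and "\<And>M F. (M, F) \<in> causal_multiteams \<sigma> \<Longrightarrow> M \<noteq> {#} \<Longrightarrow> probability_vector \<sigma> M \<in> simplex \<sigma> \<Longrightarrow>
      pco_sat \<sigma> \<phi> (M, F) \<longleftrightarrow> probability_vector \<sigma> M \<in> A"
    and "\<And>F. pco_sat \<sigma> \<phi> ({#}, F)"
  shows "truth_class \<sigma> \<phi> = team_class \<sigma> A"
proof -
  have "pco_sat \<sigma> \<phi> (M, F) \<longleftrightarrow> M = {#} \<or> probability_vector \<sigma> M \<in> A"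
    if "(M, F) \<in> causal_multiteams \<sigma>" for M F
    using that assms probability_vector_simplex[OF assms(1) that] by blast
  then show ?thesis unfolding truth_class_def team_class_def by force
qed

lemma truth_class_PrGe:
  assumes "signature \<sigma>" "box_free \<alpha>"
  shows "truth_class \<sigma> (PrGe \<alpha> b) = team_class \<sigma> {e \<in> simplex \<sigma>. b \<le> sum e (extension \<sigma> \<alpha>)}"
  using assms by (intro truth_class_eqI) (auto simp: prob_box_free)

lemma truth_class_PrGt:
  assumes "signature \<sigma>" "box_free \<alpha>"
  shows "truth_class \<sigma> (PrGt \<alpha> b) = team_class \<sigma> {e \<in> simplex \<sigma>. b < sum e (extension \<sigma> \<alpha>)}"
  using assms by (intro truth_class_eqI) (auto simp: prob_box_free)

lemma truth_class_PrGePr: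
  assumes "signature \<sigma>" "box_free \<alpha>" "box_free \<beta>"
  shows "truth_class \<sigma> (PrGePr \<alpha> \<beta>) =
    team_class \<sigma> {e \<in> simplex \<sigma>. sum e (extension \<sigma> \<beta>) \<le> sum e (extension \<sigma> \<alpha>)}"
  using assms by (intro truth_class_eqI) (auto simp: prob_box_free)

lemma truth_class_PrGtPr:
  assumes "signature \<sigma>" "box_free \<alpha>" "box_free \<beta>"
  shows "truth_class \<sigma> (PrGtPr \<alpha> \<beta>) =
    team_class \<sigma> {e \<in> simplex \<sigma>. sum e (extension \<sigma> \<beta>) < sum e (extension \<sigma> \<alpha>)}"
  using assms by (intro truth_class_eqI) (auto simp: prob_box_free)

text \<open>Probability 1 means that every row satisfies \<alpha>, which by flatness is \<alpha>
  itself. Literals thereby reduce to probabilistic atoms.\<close>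

lemma pco_sat_PrGe_1: "pco_sat \<sigma> (PrGe \<alpha> 1) T \<longleftrightarrow> co_sat \<sigma> \<alpha> T"
proof -
  obtain M F where [simp]: "T = (M, F)" by (cases T)
  let ?M = "filter_mset (\<lambda>s. co_sat \<sigma> \<alpha> ({#s#}, F)) M"
  \<comment> \<open>A submultiset that is not smaller than the whole is the whole.\<close>
  have "size M \<le> size ?M \<longleftrightarrow> ?M = M"
    by (metis multiset_filter_subset mset_subset_size leD order_refl subset_mset.le_neq_trans)
  then have "pco_sat \<sigma> (PrGe \<alpha> 1) T \<longleftrightarrow> M = {#} \<or> ?M = M"
    by (auto simp: prob_def submultiteam_def le_divide_eq)
  also have "\<dots> \<longleftrightarrow> (\<forall>s\<in>#M. co_sat \<sigma> \<alpha> ({#s#}, F))"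
    by (auto simp: filter_mset_eq_conv)
  finally show ?thesis by (simp add: co_sat_flat[of _ _ M])
qed

lemma truth_class_PEq: "truth_class \<sigma> (PEq Y y) = truth_class \<sigma> (PrGe (CEq Y y) 1)"
  unfolding truth_class_def pco_sat_PrGe_1 by simp

lemma truth_class_PNeq: "truth_class \<sigma> (PNeq Y y) = truth_class \<sigma> (PrGe (CNeq Y y) 1)"
  unfolding truth_class_def pco_sat_PrGe_1 by simp

section \<open>Connectives and finite unions of systems\<close>

lemma truth_class_PAnd: "truth_class \<sigma> (PAnd \<phi> \<psi>) = truth_class \<sigma> \<phi> \<inter> truth_class \<sigma> \<psi>"
  by (auto simp: truth_class_def)

lemma truth_class_PDisj: "truth_class \<sigma> (PDisj \<phi> \<psi>) = truth_class \<sigma> \<phi> \<union> truth_class \<sigma> \<psi>"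
  by (auto simp: truth_class_def)

lemma team_class_Int: "team_class \<sigma> (A \<inter> B) = team_class \<sigma> A \<inter> team_class \<sigma> B"
  by (auto simp: team_class_def)

lemma team_class_Un: "team_class \<sigma> (A \<union> B) = team_class \<sigma> A \<union> team_class \<sigma> B"
  by (auto simp: team_class_def)

lemma finite_union_of_systems_ineq:
  "Q I \<Longrightarrow> finite_union_of_systems \<sigma> Q {e \<in> simplex \<sigma>. ineq_holds \<sigma> e I}"
  unfolding finite_union_of_systems_def defined_by_def by (intro exI[of _ "{{I}}"]) auto

lemma finite_union_of_systems_Un:
  assumes "finite_union_of_systems \<sigma> Q A" "finite_union_of_systems \<sigma> Q B"
  shows "finite_union_of_systems \<sigma> Q (A \<union> B)"
proof -
  from assms obtain \<A> \<B> where "finite \<A>" "\<forall>S\<in>\<A>. finite S \<and> (\<forall>I\<in>S. Q I)" "A = (\<Union>S\<in>\<A>. defined_by \<sigma> S)"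
    "finite \<B>" "\<forall>S\<in>\<B>. finite S \<and> (\<forall>I\<in>S. Q I)" "B = (\<Union>S\<in>\<B>. defined_by \<sigma> S)"
    unfolding finite_union_of_systems_def by auto
  then show ?thesis
    unfolding finite_union_of_systems_def by (intro exI[of _ "\<A> \<union> \<B>"]) auto
qed

text \<open>Intersection distributes over the two unions, and two systems hold jointly when their
  union does.\<close>

lemma finite_union_of_systems_Int:
  assumes "finite_union_of_systems \<sigma> Q A" "finite_union_of_systems \<sigma> Q B"
  shows "finite_union_of_systems \<sigma> Q (A \<inter> B)"
proof -
  from assms obtain \<A> \<B> where *: "finite \<A>" "\<forall>S\<in>\<A>. finite S \<and> (\<forall>I\<in>S. Q I)" "A = (\<Union>S\<in>\<A>. defined_by \<sigma> S)"
    "finite \<B>" "\<forall>S\<in>\<B>. finite S \<and> (\<forall>I\<in>S. Q I)" "B = (\<Union>S\<in>\<B>. defined_by \<sigma> S)"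
    unfolding finite_union_of_systems_def by auto
  have merge: "defined_by \<sigma> S \<inter> defined_by \<sigma> S' = defined_by \<sigma> (S \<union> S')" for S S'
    by (auto simp: defined_by_def)
  then have "A \<inter> B = (\<Union>S\<in>(\<lambda>(S, S'). S \<union> S') ` (\<A> \<times> \<B>). defined_by \<sigma> S)"
    unfolding *(3,6) by (auto simp flip: merge)
  with * show ?thesis
    unfolding finite_union_of_systems_def
    by (intro exI[of _ "(\<lambda>(S, S'). S \<union> S') ` (\<A> \<times> \<B>)"]) auto
qed

lemma finite_union_of_systems_subset: "finite_union_of_systems \<sigma> Q A \<Longrightarrow> A \<subseteq> simplex \<sigma>"
  by (auto simp: finite_union_of_systems_def defined_by_def)

lemma sum_of_bool_assignments:
  fixes e :: "('v \<Rightarrow> 'a) \<Rightarrow> rat"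
  assumes "signature \<sigma>" "A \<subseteq> assignments \<sigma>"
  shows "(\<Sum>s\<in>assignments \<sigma>. of_bool (s \<in> A) * e s) = sum e A"
  using assms finite_assignments[OF assms(1)]
  by (simp add: sum_of_bool_mult_eq Int_absorb1 Collect_mem_eq)

lemma extension_subset: "extension \<sigma> \<alpha> \<subseteq> assignments \<sigma>"
  by (auto simp: extension_def)

section \<open>From formulas to systems of inequalities\<close>

lemma systems_PrGe:
  assumes \<sigma>: "signature \<sigma>" and Q: "\<And>I. monic_ineq \<sigma> I \<Longrightarrow> Q I" and \<alpha>: "box_free \<alpha>"
  shows "\<exists>A. finite_union_of_systems \<sigma> Q A \<and> truth_class \<sigma> (PrGe \<alpha> b) = team_class \<sigma> A"
proof -
  let ?I = "Ineq (\<lambda>s. of_bool (s \<in> extension \<sigma> \<alpha>)) Ge b"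
  have "Q ?I" by (rule Q) (auto simp: monic_ineq_def)
  from finite_union_of_systems_ineq[of Q _ \<sigma>, OF this] show ?thesis
    unfolding truth_class_PrGe[OF \<sigma> \<alpha>]
    by (auto simp: ineq_holds_def sum_of_bool_assignments[OF \<sigma> extension_subset])
qed

lemma systems_of_formula:
  assumes \<sigma>: "signature \<sigma>" and Q: "\<And>I. monic_ineq \<sigma> I \<Longrightarrow> Q I"
    and "in_P \<phi>" "comparison_free \<phi> \<or> (\<forall>I. signed_monic_ineq \<sigma> I \<longrightarrow> Q I)"
  shows "\<exists>A. finite_union_of_systems \<sigma> Q A \<and> truth_class \<sigma> \<phi> = team_class \<sigma> A"
  using assms(3,4)
proof (induction \<phi>)
  case (PEq Y y)
  show ?case unfolding truth_class_PEq by (rule systems_PrGe[OF \<sigma> Q]) simp_all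
next
  case (PNeq Y y)
  show ?case unfolding truth_class_PNeq by (rule systems_PrGe[OF \<sigma> Q]) simp_all
next
  case (PrGe \<alpha> b)
  then show ?case by (intro systems_PrGe[OF \<sigma> Q]) simp_all
next
  case (PrGt \<alpha> b)
  then have \<alpha>: "box_free \<alpha>" by simp
  let ?I = "Ineq (\<lambda>s. of_bool (s \<in> extension \<sigma> \<alpha>)) Gt b"
  have "Q ?I" by (rule Q) (auto simp: monic_ineq_def)
  from finite_union_of_systems_ineq[of Q _ \<sigma>, OF this] show ?case
    unfolding truth_class_PrGt[OF \<sigma> \<alpha>]
    by (auto simp: ineq_holds_def sum_of_bool_assignments[OF \<sigma> extension_subset])
next
  case (PrGePr \<alpha> \<beta>)
  then have \<alpha>\<beta>: "box_free \<alpha>" "box_free \<beta>" by simp_all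
  \<comment> \<open>Assignments in both extensions cancel to coefficient 0, and the bound 0 meets
    the homogeneity demand for mixed signs.\<close>
  let ?I = "Ineq (\<lambda>s. of_bool (s \<in> extension \<sigma> \<alpha>) - of_bool (s \<in> extension \<sigma> \<beta>)) Ge 0"
  have "Q ?I" using PrGePr by (auto simp: signed_monic_ineq_def)
  from finite_union_of_systems_ineq[of Q _ \<sigma>, OF this] show ?case
    unfolding truth_class_PrGePr[OF \<sigma> \<alpha>\<beta>]
    by (auto simp: ineq_holds_def left_diff_distrib sum_subtractf sum_of_bool_assignments[OF \<sigma> extension_subset])
next
  case (PrGtPr \<alpha> \<beta>)
  then have \<alpha>\<beta>: "box_free \<alpha>" "box_free \<beta>" by simp_all
  let ?I = "Ineq (\<lambda>s. of_bool (s \<in> extension \<sigma> \<alpha>) - of_bool (s \<in> extension \<sigma> \<beta>)) Gt 0"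
  have "Q ?I" using PrGtPr by (auto simp: signed_monic_ineq_def)
  from finite_union_of_systems_ineq[of Q _ \<sigma>, OF this] show ?case
    unfolding truth_class_PrGtPr[OF \<sigma> \<alpha>\<beta>]
    by (auto simp: ineq_holds_def left_diff_distrib sum_subtractf sum_of_bool_assignments[OF \<sigma> extension_subset])
next
  case (PAnd \<phi> \<psi>)
  then show ?case
    unfolding truth_class_PAnd by simp (metis finite_union_of_systems_Int team_class_Int)
next
  case (PDisj \<phi> \<psi>)
  then show ?case
    unfolding truth_class_PDisj by simp (metis finite_union_of_systems_Un team_class_Un)
qed simp_all

section \<open>Expressing inequalities\<close>

lemma sum_simplex_nonneg:
  assumes "e \<in> simplex \<sigma>" "A \<subseteq> assignments \<sigma>"
  shows "0 \<le> sum e A"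
  using assms by (intro sum_nonneg) (auto simp: simplex_def)

lemma sum_simplex_Compl:
  assumes "signature \<sigma>" "e \<in> simplex \<sigma>" "A \<subseteq> assignments \<sigma>"
  shows "sum e (assignments \<sigma> - A) = 1 - sum e A"
  using assms finite_assignments[OF assms(1)] by (simp add: sum_diff simplex_def)

lemma sum_simplex_le_1:
  assumes "signature \<sigma>" "e \<in> simplex \<sigma>" "A \<subseteq> assignments \<sigma>"
  shows "sum e A \<le> 1"
  using sum_simplex_nonneg[OF assms(2), of "assignments \<sigma> - A"] sum_simplex_Compl[OF assms] by simp

lemma expressible_mono: "expressible \<sigma> L A \<Longrightarrow> L \<subseteq> L' \<Longrightarrow> expressible \<sigma> L' A"
  unfolding expressible_def by blast

text \<open>A formula with empty extension has probability 0 on nonempty multiteams, so there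
  \<open>Pr(\<alpha>) > 1\<close> fails; empty multiteams still satisfy it.\<close>

lemma expressible_empty:
  assumes \<sigma>: "signature \<sigma>"
  shows "expressible \<sigma> (P_minus_lang \<sigma>) {}"
proof -
  obtain \<alpha> where "co_formula \<sigma> \<alpha>" "box_free \<alpha>" "extension \<sigma> \<alpha> = {}"
    using ex_co_extension[OF \<sigma> empty_subsetI] .
  then show ?thesis
    unfolding expressible_def
    by (intro bexI[of _ "PrGt \<alpha> 1"]) (simp_all add: truth_class_PrGt[OF \<sigma>] P_minus_lang_def P_lang_def)
qed

lemma expressible_simplex:
  assumes \<sigma>: "signature \<sigma>"
  shows "expressible \<sigma> (P_minus_lang \<sigma>) (simplex \<sigma>)"
proof -
  obtain \<alpha> where "co_formula \<sigma> \<alpha>" "box_free \<alpha>" "extension \<sigma> \<alpha> = {}"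
    using ex_co_extension[OF \<sigma> empty_subsetI] .
  then show ?thesis
    unfolding expressible_def
    by (intro bexI[of _ "PrGe \<alpha> 0"]) (simp_all add: truth_class_PrGe[OF \<sigma>] P_minus_lang_def P_lang_def)
qed

text \<open>Atoms admit only bounds in the unit interval. Masses lie in it too, so any other bound
  makes the condition always true or always false.\<close>

lemma expressible_ge:
  assumes \<sigma>: "signature \<sigma>" and A: "A \<subseteq> assignments \<sigma>"
  shows "expressible \<sigma> (P_minus_lang \<sigma>) {e \<in> simplex \<sigma>. b \<le> sum e A}"
proof -
  consider "b < 0" | "1 < b" | "0 \<le> b" "b \<le> 1" by linarith
  then show ?thesis
  proof cases
    case 1
    then have "{e \<in> simplex \<sigma>. b \<le> sum e A} = simplex \<sigma>"
      using sum_simplex_nonneg[OF _ A] by fastforce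
    with expressible_simplex[OF \<sigma>] show ?thesis by simp
  next
    case 2
    then have "{e \<in> simplex \<sigma>. b \<le> sum e A} = {}"
      using sum_simplex_le_1[OF \<sigma> _ A] by fastforce
    with expressible_empty[OF \<sigma>] show ?thesis by (simp only:)
  next
    case 3
    obtain \<alpha> where "co_formula \<sigma> \<alpha>" "box_free \<alpha>" "extension \<sigma> \<alpha> = A"
      using ex_co_extension[OF \<sigma> A] .
    with 3 show ?thesis
      unfolding expressible_def
      by (intro bexI[of _ "PrGe \<alpha> b"]) (simp_all add: truth_class_PrGe[OF \<sigma>] P_minus_lang_def P_lang_def)
  qed
qed

lemma expressible_gt:
  assumes \<sigma>: "signature \<sigma>" and A: "A \<subseteq> assignments \<sigma>"
  shows "expressible \<sigma> (P_minus_lang \<sigma>) {e \<in> simplex \<sigma>. b < sum e A}"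
proof -
  consider "b < 0" | "1 < b" | "0 \<le> b" "b \<le> 1" by linarith
  then show ?thesis
  proof cases
    case 1
    then have "{e \<in> simplex \<sigma>. b < sum e A} = simplex \<sigma>"
      using sum_simplex_nonneg[OF _ A] by fastforce
    with expressible_simplex[OF \<sigma>] show ?thesis by simp
  next
    case 2
    then have "{e \<in> simplex \<sigma>. b < sum e A} = {}"
      using sum_simplex_le_1[OF \<sigma> _ A] by fastforce
    with expressible_empty[OF \<sigma>] show ?thesis by (simp only:)
  next
    case 3
    obtain \<alpha> where "co_formula \<sigma> \<alpha>" "box_free \<alpha>" "extension \<sigma> \<alpha> = A"
      using ex_co_extension[OF \<sigma> A] .
    with 3 show ?thesis
      unfolding expressible_def
      by (intro bexI[of _ "PrGt \<alpha> b"]) (simp_all add: truth_class_PrGt[OF \<sigma>] P_minus_lang_def P_lang_def)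
  qed
qed

text \<open>Atoms give only lower bounds; an upper bound on the mass of \<open>A\<close> is a lower
  bound on the mass of its complement.\<close>

lemma expressible_rel:
  assumes \<sigma>: "signature \<sigma>" and A: "A \<subseteq> assignments \<sigma>"
  shows "expressible \<sigma> (P_minus_lang \<sigma>) {e \<in> simplex \<sigma>. rel_holds r (sum e A) b}"
proof -
  have le: "{e \<in> simplex \<sigma>. sum e A \<le> b} = {e \<in> simplex \<sigma>. 1 - b \<le> sum e (assignments \<sigma> - A)}"
    using sum_simplex_Compl[OF \<sigma> _ A] by auto
  have lt: "{e \<in> simplex \<sigma>. sum e A < b} = {e \<in> simplex \<sigma>. 1 - b < sum e (assignments \<sigma> - A)}"
    using sum_simplex_Compl[OF \<sigma> _ A] by auto
  show ?thesis
    using expressible_ge[OF \<sigma> A] expressible_gt[OF \<sigma> A]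
      expressible_ge[OF \<sigma> Diff_subset] expressible_gt[OF \<sigma> Diff_subset]
    by (cases r) (simp_all add: le lt)
qed

lemma expressible_comparison:
  assumes \<sigma>: "signature \<sigma>" and A: "A \<subseteq> assignments \<sigma>" and B: "B \<subseteq> assignments \<sigma>"
  shows "expressible \<sigma> (P_lang \<sigma>) {e \<in> simplex \<sigma>. rel_holds r (sum e A) (sum e B)}"
proof -
  obtain \<alpha> where \<alpha>: "co_formula \<sigma> \<alpha>" "box_free \<alpha>" "extension \<sigma> \<alpha> = A"
    using ex_co_extension[OF \<sigma> A] .
  obtain \<beta> where \<beta>: "co_formula \<sigma> \<beta>" "box_free \<beta>" "extension \<sigma> \<beta> = B"
    using ex_co_extension[OF \<sigma> B] .
  define \<phi> where "\<phi> = (case r of Ge \<Rightarrow> PrGePr \<alpha> \<beta> | Le \<Rightarrow> PrGePr \<beta> \<alpha> | Gt \<Rightarrow> PrGtPr \<alpha> \<beta> | Lt \<Rightarrow> PrGtPr \<beta> \<alpha>)"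
  have "\<phi> \<in> P_lang \<sigma>" using \<alpha> \<beta> by (cases r) (simp_all add: \<phi>_def P_lang_def)
  moreover have "truth_class \<sigma> \<phi> = team_class \<sigma> {e \<in> simplex \<sigma>. rel_holds r (sum e A) (sum e B)}"
    using \<alpha> \<beta> by (cases r) (simp_all add: \<phi>_def truth_class_PrGePr[OF \<sigma>] truth_class_PrGtPr[OF \<sigma>])
  ultimately show ?thesis unfolding expressible_def by blast
qed

text \<open>Rewrites a signed sum through masses of sets, the only quantities that atoms
  mention.\<close>

lemma sum_signed_coeffs:
  fixes c e :: "('v \<Rightarrow> 'a) \<Rightarrow> rat"
  assumes \<sigma>: "signature \<sigma>" and c: "\<forall>s\<in>assignments \<sigma>. c s \<in> {0, 1, -1}"
  shows "(\<Sum>s\<in>assignments \<sigma>. c s * e s) =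
    sum e {s \<in> assignments \<sigma>. c s = 1} - sum e {s \<in> assignments \<sigma>. c s = -1}"
proof -
  let ?A = "{s \<in> assignments \<sigma>. c s = 1}" and ?B = "{s \<in> assignments \<sigma>. c s = -1}"
  have "(\<Sum>s\<in>assignments \<sigma>. c s * e s) =
      (\<Sum>s\<in>assignments \<sigma>. of_bool (s \<in> ?A) * e s - of_bool (s \<in> ?B) * e s)"
    using c by (intro sum.cong) auto
  also have "\<dots> = sum e ?A - sum e ?B"
    unfolding sum_subtractf by (simp only: sum_of_bool_assignments[OF \<sigma> Collect_restrict])
  finally show ?thesis .
qed

lemma expressible_monic_ineq:
  assumes \<sigma>: "signature \<sigma>" and "monic_ineq \<sigma> I"
  shows "expressible \<sigma> (P_minus_lang \<sigma>) {e \<in> simplex \<sigma>. ineq_holds \<sigma> e I}"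
proof -
  have c: "\<forall>s\<in>assignments \<sigma>. coeffs I s \<in> {0, 1, -1}" using assms(2) by (auto simp: monic_ineq_def)
  have neg: "{s \<in> assignments \<sigma>. coeffs I s = -1} = {}"
    using assms(2) by (force simp: monic_ineq_def)
  show ?thesis
    unfolding ineq_holds_def sum_signed_coeffs[OF \<sigma> c] neg
    using expressible_rel[OF \<sigma> Collect_restrict] by simp
qed

text \<open>If only one sign occurs, a single mass is compared with a constant. If both occur,
  homogeneity forces the bound 0, leaving a comparison of two masses.\<close>

lemma expressible_signed_monic_ineq:
  assumes \<sigma>: "signature \<sigma>" and I: "signed_monic_ineq \<sigma> I"
  shows "expressible \<sigma> (P_lang \<sigma>) {e \<in> simplex \<sigma>. ineq_holds \<sigma> e I}"
proof -
  let ?A = "{s \<in> assignments \<sigma>. coeffs I s = 1}" and ?B = "{s \<in> assignments \<sigma>. coeffs I s = -1}"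
  have c: "\<forall>s\<in>assignments \<sigma>. coeffs I s \<in> {0, 1, -1}" using I by (auto simp: signed_monic_ineq_def)
  have minus: "P_minus_lang \<sigma> \<subseteq> P_lang \<sigma>" by (auto simp: P_minus_lang_def)
  consider "?B = {}" | "?A = {}" | "bound I = 0" using I unfolding signed_monic_ineq_def by blast
  then show ?thesis
  proof cases
    case 1
    show ?thesis
      unfolding ineq_holds_def sum_signed_coeffs[OF \<sigma> c] 1
      using expressible_rel[OF \<sigma> Collect_restrict, THEN expressible_mono, OF minus] by simp
  next
    case 2
    \<comment> \<open>Multiplying by -1 mirrors the relation and negates the bound.\<close>
    define r where "r = (case relation I of Ge \<Rightarrow> Le | Le \<Rightarrow> Ge | Gt \<Rightarrow> Lt | Lt \<Rightarrow> Gt)"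
    have "rel_holds (relation I) (- x) (bound I) \<longleftrightarrow> rel_holds r x (- bound I)" for x
      unfolding r_def by (cases "relation I") auto
    then show ?thesis
      unfolding ineq_holds_def sum_signed_coeffs[OF \<sigma> c] 2
      using expressible_rel[OF \<sigma> Collect_restrict, THEN expressible_mono, OF minus] by simp
  next
    case 3
    have "rel_holds r (x - y) 0 \<longleftrightarrow> rel_holds r x y" for r x y by (cases r) auto
    then show ?thesis
      unfolding ineq_holds_def sum_signed_coeffs[OF \<sigma> c] 3
      using expressible_comparison[OF \<sigma> Collect_restrict Collect_restrict] by simp
  qed
qed

text \<open>The language only has to express single inequalities and be closed under the two
  connectives; the empty set and the simplex account for the empty union and the empty
  system.\<close>

lemma expressible_finite_union_of_systems:
  assumes "\<And>\<phi> \<psi>. \<phi> \<in> L \<Longrightarrow> \<psi> \<in> L \<Longrightarrow> PAnd \<phi> \<psi> \<in> L" "\<And>\<phi> \<psi>. \<phi> \<in> L \<Longrightarrow> \<psi> \<in> L \<Longrightarrow> PDisj \<phi> \<psi> \<in> L"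
    and empty: "expressible \<sigma> L {}" and simplex: "expressible \<sigma> L (simplex \<sigma>)"
    and ineq: "\<And>I. Q I \<Longrightarrow> expressible \<sigma> L {e \<in> simplex \<sigma>. ineq_holds \<sigma> e I}"
    and "finite_union_of_systems \<sigma> Q A"
  shows "expressible \<sigma> L A"
proof -
  have Int: "expressible \<sigma> L (A \<inter> B)" if "expressible \<sigma> L A" "expressible \<sigma> L B" for A B
    using that assms(1) unfolding expressible_def by (metis truth_class_PAnd team_class_Int)
  have Un: "expressible \<sigma> L (A \<union> B)" if "expressible \<sigma> L A" "expressible \<sigma> L B" for A B
    using that assms(2) unfolding expressible_def by (metis truth_class_PDisj team_class_Un)
  have system: "expressible \<sigma> L (defined_by \<sigma> S)" if "finite S" "\<forall>I\<in>S. Q I" for S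
    using that
  proof (induction S rule: finite_induct)
    case empty
    with simplex show ?case by (simp add: defined_by_def)
  next
    case (insert I S)
    have "defined_by \<sigma> (insert I S) = {e \<in> simplex \<sigma>. ineq_holds \<sigma> e I} \<inter> defined_by \<sigma> S"
      by (auto simp: defined_by_def)
    with insert Int ineq show ?case by simp
  qed
  have "expressible \<sigma> L (\<Union>S\<in>\<S>. defined_by \<sigma> S)"
    if "finite \<S>" "\<forall>S\<in>\<S>. finite S \<and> (\<forall>I\<in>S. Q I)" for \<S>
    using that by (induction \<S> rule: finite_induct) (simp_all add: empty Un system)
  with assms(6) show ?thesis unfolding finite_union_of_systems_def by blast
qed

text \<open>Keeping \<open>L\<close> and \<open>Q\<close> abstract gives both equivalences of the
  theorem from one argument.\<close>

lemma definable_iff: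
  assumes \<sigma>: "signature \<sigma>" and K: "K \<subseteq> causal_multiteams \<sigma>"
    and systems: "\<And>\<phi>. \<phi> \<in> L \<Longrightarrow> \<exists>A. finite_union_of_systems \<sigma> Q A \<and> truth_class \<sigma> \<phi> = team_class \<sigma> A"
    and expressible: "\<And>A. finite_union_of_systems \<sigma> Q A \<Longrightarrow> expressible \<sigma> L A"
  shows "definable_in \<sigma> L K \<longleftrightarrow> finite_union_of_systems \<sigma> Q (probability_set \<sigma> K) \<and>
    empty_multiteam_property \<sigma> K \<and> closed_under_change_of_laws \<sigma> K \<and> closed_under_rescaling \<sigma> K"
proof -
  have "definable_in \<sigma> L K \<longleftrightarrow> (\<exists>A. finite_union_of_systems \<sigma> Q A \<and> K = team_class \<sigma> A)"
    unfolding definable_in_def truth_class_def[symmetric]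
    using systems expressible unfolding expressible_def by metis
  \<comment> \<open>\<open>A\<close> lies in the simplex, so it is recovered from its class and must
    be the probability set of \<open>K\<close>.\<close>
  also have "\<dots> \<longleftrightarrow> finite_union_of_systems \<sigma> Q (probability_set \<sigma> K) \<and>
      K = team_class \<sigma> (probability_set \<sigma> K)"
    using probability_set_team_class[OF \<sigma> finite_union_of_systems_subset] by metis
  finally show ?thesis using closed_class_iff[OF K] by blast
qed

theorem theorem4:
  fixes \<sigma> :: "('v, 'a) sig" and K :: "('v, 'a) cmteam set"
  assumes "signature \<sigma>" and "K \<subseteq> causal_multiteams \<sigma>"
  shows "(definable_in \<sigma> (P_minus_lang \<sigma>) K \<longleftrightarrow>
            monic \<sigma> K \<and> empty_multiteam_property \<sigma> K \<and>
            closed_under_change_of_laws \<sigma> K \<and> closed_under_rescaling \<sigma> K) \<and>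
         (definable_in \<sigma> (P_lang \<sigma>) K \<longleftrightarrow>
            signed_monic \<sigma> K \<and> empty_multiteam_property \<sigma> K \<and>
            closed_under_change_of_laws \<sigma> K \<and> closed_under_rescaling \<sigma> K)"
proof -
  note \<sigma> = assms(1)
  have minus: "P_minus_lang \<sigma> \<subseteq> P_lang \<sigma>" by (auto simp: P_minus_lang_def)
  \<comment> \<open>No coefficient is -1, so the homogeneity clause is vacuous.\<close>
  have signed: "signed_monic_ineq \<sigma> I" if "monic_ineq \<sigma> I" for I
    using that unfolding monic_ineq_def signed_monic_ineq_def by force
  \<comment> \<open>The two premises left open are the closure of the language under conjunction and
    global disjunction.\<close>
  have "expressible \<sigma> (P_minus_lang \<sigma>) A" if "finite_union_of_systems \<sigma> (monic_ineq \<sigma>) A" for A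
    using _ _ expressible_empty[OF \<sigma>] expressible_simplex[OF \<sigma>] expressible_monic_ineq[OF \<sigma>] that
    by (rule expressible_finite_union_of_systems) (simp_all add: P_minus_lang_def P_lang_def)
  moreover have "\<exists>A. finite_union_of_systems \<sigma> (monic_ineq \<sigma>) A \<and> truth_class \<sigma> \<phi> = team_class \<sigma> A"
    if "\<phi> \<in> P_minus_lang \<sigma>" for \<phi>
    using that by (intro systems_of_formula[OF \<sigma>]) (auto simp: P_minus_lang_def P_lang_def)
  moreover have "expressible \<sigma> (P_lang \<sigma>) A" if "finite_union_of_systems \<sigma> (signed_monic_ineq \<sigma>) A" for A
    using _ _ expressible_empty[OF \<sigma>, THEN expressible_mono, OF minus]
      expressible_simplex[OF \<sigma>, THEN expressible_mono, OF minus] expressible_signed_monic_ineq[OF \<sigma>] that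
    by (rule expressible_finite_union_of_systems) (simp_all add: P_lang_def)
  moreover have "\<exists>A. finite_union_of_systems \<sigma> (signed_monic_ineq \<sigma>) A \<and> truth_class \<sigma> \<phi> = team_class \<sigma> A"
    if "\<phi> \<in> P_lang \<sigma>" for \<phi>
    using that by (intro systems_of_formula[OF \<sigma>]) (auto simp: P_lang_def signed)
  ultimately show ?thesis
    unfolding monic_def signed_monic_def using definable_iff[OF assms] by blast
qed

end
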